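(* Let $G$ be a signed digraph. If $G$ has no path from a negative cycle to a positive cycle (paths of length zero allowed, so in particular no vertex lies on both a negative and a positive cycle), then $G$ is trap-separating.
   Context: A signed digraph $G=(V,E)$ has a finite vertex set $V$ and arc set $E\subseteq V\times V\times\{-1,1\}$; $(j,i,s)\in E$ is an arc from $j$ to $i$ of sign $s$ (loops and parallel arcs of opposite signs allowed). Cycles and paths are simple subgraphs; the sign of a cycle is the product of the signs of its arcs. A path from a cycle $C$ to a cycle $C'$ is a path from a vertex of $C$ to a vertex of $C'$. A configuration is an element of $\{0,1\}^V$; $e_j$ is the configuration equal to $1$ exactly at $j$; $+$ is addition mod 2. A BN on $V$ is a map $f:\{0,1\}^V\to\{0,1\}^V$; $G(f)$ has a positive (negative) arc from $j$ to $i$ iff for some $x$ with $x_j=0$, $f_i(x+e_j)-f_i(x)$ is positive (negative). $F(G)=\{f: G(f)=G\}$. The asynchronous graph $\Gamma(f)$ on $\{0,1\}^V$ has an arc $x\to x+e_i$ whenever $f_i(x)\neq x_i$. A trap set has no arc leaving it; an attractor is an inclusion-minimal nonempty trap set. A subspace is a set $\{x: x_i=c(i)\ \forall i\in I\}$; a trap space is a subspace that is a trap set; $\langle X\rangle$ is the smallest trap space containing $X$. $\Gamma(f)$ is trap-separating if $\langle A\rangle\cap\langle B\rangle=\emptyset$ for all distinct attractors $A,B$; $G$ is trap-separating if $\Gamma(f)$ is for every $f\in F(G)$. *)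

theory Defs
  imports "Graph_Theory.Arc_Walk" "HOL-Library.FuncSet"
begin

text \<open>
  An arc is a triple \<open>(j, i, s)\<close> from \<open>j\<close> to \<open>i\<close> of sign \<open>s\<close>; being its own label, it gives
  loops and parallel arcs of opposite signs, but no parallel arcs of equal sign.
\<close>

type_synonym 'v sdigraph = "('v, 'v \<times> 'v \<times> int) pre_digraph"

definition mk_sdigraph :: "'v set \<Rightarrow> ('v \<times> 'v \<times> int) set \<Rightarrow> 'v sdigraph" where
  "mk_sdigraph V E = \<lparr>verts = V, arcs = E, tail = fst, head = fst \<circ> snd\<rparr>"

definition signed_digraph :: "'v sdigraph \<Rightarrow> bool" where
  "signed_digraph G \<longleftrightarrow>
     (\<exists>V E. finite V \<and> E \<subseteq> V \<times> V \<times> {-1, 1} \<and> G = mk_sdigraph V E)"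

lemma signed_digraph_imp_fin_digraph:
  assumes "signed_digraph G"
  shows "fin_digraph G"
proof -
  obtain V E where "finite V" and E: "E \<subseteq> V \<times> V \<times> {-1, 1}" and G: "G = mk_sdigraph V E"
    using assms unfolding signed_digraph_def by blast
  moreover have "finite E"
    using \<open>finite V\<close> by (intro finite_subset[OF E]) auto
  ultimately show ?thesis
    by unfold_locales (auto simp: mk_sdigraph_def)
qed

text \<open>
  A cycle is given by the list of its arcs, starting from any of its vertices.
\<close>

definition cycle_sign :: "('v \<times> 'v \<times> int) list \<Rightarrow> int" where
  "cycle_sign C = (\<Prod>(j, i, s)\<leftarrow>C. s)"

definition positive_cycle :: "'v sdigraph \<Rightarrow> ('v \<times> 'v \<times> int) list \<Rightarrow> bool" where
  "positive_cycle G C \<longleftrightarrow> pre_digraph.cycle G C \<and> cycle_sign C = 1"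

definition negative_cycle :: "'v sdigraph \<Rightarrow> ('v \<times> 'v \<times> int) list \<Rightarrow> bool" where
  "negative_cycle G C \<longleftrightarrow> pre_digraph.cycle G C \<and> cycle_sign C = -1"

definition cycle_verts :: "'v sdigraph \<Rightarrow> ('v \<times> 'v \<times> int) list \<Rightarrow> 'v set" where
  "cycle_verts G C = tail G ` set C"

text \<open>
  The path may have length zero: \<open>apath u [] u\<close> holds for every vertex \<open>u\<close>.
\<close>

definition path_between_cycles ::
    "'v sdigraph \<Rightarrow> ('v \<times> 'v \<times> int) list \<Rightarrow> ('v \<times> 'v \<times> int) list \<Rightarrow> ('v \<times> 'v \<times> int) list \<Rightarrow> bool" where
  "path_between_cycles G C p C' \<longleftrightarrow>
     (\<exists>u \<in> cycle_verts G C. \<exists>v \<in> cycle_verts G C'. pre_digraph.apath G u p v)"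

type_synonym 'v config = "'v \<Rightarrow> int"

definition configs :: "'v set \<Rightarrow> 'v config set" where
  "configs V = V \<rightarrow>\<^sub>E {0, 1}"

definition config_add :: "'v set \<Rightarrow> 'v config \<Rightarrow> 'v config \<Rightarrow> 'v config" where
  "config_add V x y = (\<lambda>i\<in>V. (x i + y i) mod 2)"

definition unit_config :: "'v set \<Rightarrow> 'v \<Rightarrow> 'v config" where
  "unit_config V j = (\<lambda>i\<in>V. if i = j then 1 else 0)"

definition boolean_networks :: "'v set \<Rightarrow> ('v config \<Rightarrow> 'v config) set" where
  "boolean_networks V = configs V \<rightarrow>\<^sub>E configs V"

definition interaction_graph :: "'v set \<Rightarrow> ('v config \<Rightarrow> 'v config) \<Rightarrow> 'v sdigraph" where
  "interaction_graph V f = mk_sdigraph V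
     ({(j, i, 1) | j i. j \<in> V \<and> i \<in> V \<and>
         (\<exists>x \<in> configs V. x j = 0 \<and> f (config_add V x (unit_config V j)) i - f x i > 0)} \<union>
      {(j, i, -1) | j i. j \<in> V \<and> i \<in> V \<and>
         (\<exists>x \<in> configs V. x j = 0 \<and> f (config_add V x (unit_config V j)) i - f x i < 0)})"

definition networks_on :: "'v sdigraph \<Rightarrow> ('v config \<Rightarrow> 'v config) set" where
  "networks_on G = {f \<in> boolean_networks (verts G). interaction_graph (verts G) f = G}"

text \<open>
  The asynchronous graph is represented by its arc relation on \<open>configs V\<close>.
\<close>

definition async_graph :: "'v set \<Rightarrow> ('v config \<Rightarrow> 'v config) \<Rightarrow> 'v config rel" where
  "async_graph V f =
     {(x, config_add V x (unit_config V i)) | x i. x \<in> configs V \<and> i \<in> V \<and> f x i \<noteq> x i}"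

definition trap_set :: "'v set \<Rightarrow> 'v config rel \<Rightarrow> 'v config set \<Rightarrow> bool" where
  "trap_set V \<Gamma> X \<longleftrightarrow> X \<subseteq> configs V \<and> (\<forall>(x, y) \<in> \<Gamma>. x \<in> X \<longrightarrow> y \<in> X)"

definition attractor :: "'v set \<Rightarrow> 'v config rel \<Rightarrow> 'v config set \<Rightarrow> bool" where
  "attractor V \<Gamma> A \<longleftrightarrow> A \<noteq> {} \<and> trap_set V \<Gamma> A \<and>
     (\<forall>B. B \<noteq> {} \<and> trap_set V \<Gamma> B \<and> B \<subseteq> A \<longrightarrow> B = A)"

definition is_subspace :: "'v set \<Rightarrow> 'v config set \<Rightarrow> bool" where
  "is_subspace V X \<longleftrightarrow>
     (\<exists>I c. I \<subseteq> V \<and> c \<in> I \<rightarrow> {0, 1} \<and> X = {x \<in> configs V. \<forall>i\<in>I. x i = c i})"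

definition trap_space :: "'v set \<Rightarrow> 'v config rel \<Rightarrow> 'v config set \<Rightarrow> bool" where
  "trap_space V \<Gamma> X \<longleftrightarrow> is_subspace V X \<and> trap_set V \<Gamma> X"

definition trap_closure :: "'v set \<Rightarrow> 'v config rel \<Rightarrow> 'v config set \<Rightarrow> 'v config set" where
  "trap_closure V \<Gamma> X = (LEAST Y. trap_space V \<Gamma> Y \<and> X \<subseteq> Y)"

definition trap_separating_graph :: "'v set \<Rightarrow> 'v config rel \<Rightarrow> bool" where
  "trap_separating_graph V \<Gamma> \<longleftrightarrow>
     (\<forall>A B. attractor V \<Gamma> A \<and> attractor V \<Gamma> B \<and> A \<noteq> B \<longrightarrow>
        trap_closure V \<Gamma> A \<inter> trap_closure V \<Gamma> B = {})"

definition trap_separating :: "'v sdigraph \<Rightarrow> bool" where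
  "trap_separating G \<longleftrightarrow>
     (\<forall>f \<in> networks_on G. trap_separating_graph (verts G) (async_graph (verts G) f))"

text \<open>
  The least trap space exists for nonempty \<open>X\<close>, in particular for attractors. For \<open>X = {}\<close> it need
  not exist, since subspaces are nonempty.
\<close>

lemma config_add_unit_in_configs:
  "x \<in> configs V \<Longrightarrow> config_add V x (unit_config V i) \<in> configs V"
  by (auto simp: configs_def config_add_def PiE_iff)

lemma is_subspace_Inter:
  assumes "\<And>Y. Y \<in> \<Y> \<Longrightarrow> is_subspace V Y" and "\<Y> \<noteq> {}" and "x \<in> \<Inter>\<Y>"
  shows "is_subspace V (\<Inter>\<Y>)"
proof -
  have "\<exists>I. I \<subseteq> V \<and> (\<forall>y. y \<in> Y \<longleftrightarrow> y \<in> configs V \<and> (\<forall>i\<in>I. y i = x i))"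
    if Y_in: "Y \<in> \<Y>" for Y
  proof -
    obtain I c where I: "I \<subseteq> V" and Y: "Y = {y \<in> configs V. \<forall>i\<in>I. y i = c i}"
      using assms(1)[OF Y_in] unfolding is_subspace_def by blast
    have "x \<in> Y"
      using assms(3) Y_in by blast
    then show ?thesis
      using I by (intro exI[of _ I]) (simp add: Y)
  qed
  then have "\<forall>Y\<in>\<Y>. \<exists>I. I \<subseteq> V \<and>
      (\<forall>y. y \<in> Y \<longleftrightarrow> y \<in> configs V \<and> (\<forall>i\<in>I. y i = x i))"
    by (intro ballI)
  from bchoice[OF this] obtain I where I_props: "\<forall>Y\<in>\<Y>. I Y \<subseteq> V \<and>
      (\<forall>y. y \<in> Y \<longleftrightarrow> y \<in> configs V \<and> (\<forall>i\<in>I Y. y i = x i))" ..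
  have I: "\<And>Y. Y \<in> \<Y> \<Longrightarrow> I Y \<subseteq> V"
    "\<And>Y y. Y \<in> \<Y> \<Longrightarrow> y \<in> Y \<longleftrightarrow> y \<in> configs V \<and> (\<forall>i\<in>I Y. y i = x i)"
    using bspec[OF I_props] by simp_all
  define J where "J = (\<Union>Y\<in>\<Y>. I Y)"
  have J: "J \<subseteq> V"
    using I(1) by (auto simp: J_def)
  obtain Y0 where "Y0 \<in> \<Y>"
    using assms(2) by blast
  then have "x \<in> configs V"
    using assms(3) I(2) by (meson InterD)
  then have "x \<in> J \<rightarrow> {0, 1}"
    using J by (auto simp: configs_def PiE_iff)
  moreover have "y \<in> \<Inter>\<Y> \<longleftrightarrow> y \<in> configs V \<and> (\<forall>i\<in>J. y i = x i)" for y
  proof -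
    have "y \<in> \<Inter>\<Y> \<longleftrightarrow> (\<forall>Y\<in>\<Y>. y \<in> configs V \<and> (\<forall>i\<in>I Y. y i = x i))"
      using I(2) by (simp add: Inter_iff)
    then show ?thesis
      using \<open>Y0 \<in> \<Y>\<close> by (auto simp: J_def)
  qed
  then have "\<Inter>\<Y> = {y \<in> configs V. \<forall>i\<in>J. y i = x i}"
    by (intro set_eqI) simp
  ultimately show ?thesis
    using J unfolding is_subspace_def by (intro exI[of _ J] exI[of _ x]) simp
qed

lemma trap_closure_least:
  assumes "X \<noteq> {}" and "X \<subseteq> configs V"
  shows "trap_space V (async_graph V f) (trap_closure V (async_graph V f) X)"
    and "X \<subseteq> trap_closure V (async_graph V f) X"
    and "\<And>Y. \<lbrakk>trap_space V (async_graph V f) Y; X \<subseteq> Y\<rbrakk> \<Longrightarrow>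
           trap_closure V (async_graph V f) X \<subseteq> Y"
proof -
  let ?\<Gamma> = "async_graph V f"
  let ?\<Y> = "{Y. trap_space V ?\<Gamma> Y \<and> X \<subseteq> Y}"
  have "is_subspace V (configs V)"
    unfolding is_subspace_def by (intro exI[of _ "{}"]) auto
  moreover have "trap_set V ?\<Gamma> (configs V)"
    by (auto simp: trap_set_def async_graph_def config_add_unit_in_configs)
  ultimately have full: "configs V \<in> ?\<Y>"
    using assms(2) by (simp add: trap_space_def)
  obtain x where "x \<in> X"
    using assms(1) by blast
  then have "x \<in> \<Inter>?\<Y>"
    by blast
  have "is_subspace V (\<Inter>?\<Y>)"
    by (rule is_subspace_Inter[of _ _ x]) (use full \<open>x \<in> \<Inter>?\<Y>\<close> in \<open>auto simp: trap_space_def\<close>)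
  moreover have "trap_set V ?\<Gamma> (\<Inter>?\<Y>)"
    using full unfolding trap_space_def trap_set_def by blast
  ultimately have ts: "trap_space V ?\<Gamma> (\<Inter>?\<Y>) \<and> X \<subseteq> \<Inter>?\<Y>"
    by (auto simp: trap_space_def)
  then have eq: "trap_closure V ?\<Gamma> X = \<Inter>?\<Y>"
    unfolding trap_closure_def by (intro Least_equality) blast+
  show "trap_space V ?\<Gamma> (trap_closure V ?\<Gamma> X)" and "X \<subseteq> trap_closure V ?\<Gamma> X"
    using ts by (simp_all only: eq)
  show "trap_closure V ?\<Gamma> X \<subseteq> Y" if "trap_space V ?\<Gamma> Y" "X \<subseteq> Y" for Y
    using that by (subst eq) blast
qed

end

theory Submission
  imports Defs
begin

text \<open>
  Let \<open>U\<close> be the set of vertices reachable from a negative cycle and \<open>W\<close> its complement. No arc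
  goes from \<open>U\<close> to \<open>W\<close>, no negative cycle meets \<open>W\<close>, and no positive cycle meets \<open>U\<close>.

  Every attractor is constant on \<open>W\<close>: among the vertices of \<open>W\<close> that vary, an initial strong
  component has no negative cycle, so after switching some signs the network is monotone there; going
  up as far as possible and then down reaches a configuration that is fixed on that component.
  Hence \<open>{x. x = a on W}\<close> is a trap space containing the attractor, where \<open>a\<close> is its value on \<open>W\<close>.

  Two attractors with the same value on \<open>W\<close> coincide: if not, take a configuration in each at
  minimal Hamming distance. Neither can move towards the other, so every vertex where they
  differ has a predecessor of the same kind, with an arc whose sign agrees with the differences;
  following these arcs backwards closes a positive cycle inside \<open>U\<close>.
\<close>

section \<open>Signs, attractors and flips of one coordinate\<close>

lemma cycle_sign_simps [simp]:
  "cycle_sign [] = 1"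
  "cycle_sign (e # p) = snd (snd e) * cycle_sign p"
  "cycle_sign (p @ q) = cycle_sign p * cycle_sign q"
  by (simp_all add: cycle_sign_def case_prod_beta)

lemma attractor_subset_configs: "attractor V \<Gamma> A \<Longrightarrow> A \<subseteq> configs V"
  by (simp add: attractor_def trap_set_def)

lemma attractors_disjoint:
  assumes "attractor V \<Gamma> A" "attractor V \<Gamma> B" "A \<noteq> B"
  shows "A \<inter> B = {}"
proof (rule ccontr)
  assume ne: "A \<inter> B \<noteq> {}"
  have "trap_set V \<Gamma> A" "trap_set V \<Gamma> B"
    using assms(1,2) by (simp_all add: attractor_def)
  then have trap: "trap_set V \<Gamma> (A \<inter> B)"
    by (auto simp: trap_set_def)
  have "A \<inter> B = A"
    using assms(1) ne trap unfolding attractor_def by (meson inf_le1)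
  moreover have "A \<inter> B = B"
    using assms(2) ne trap unfolding attractor_def by (meson inf_le2)
  ultimately show False
    using assms(3) by simp
qed

lemma configs_cases: "x \<in> configs V \<Longrightarrow> i \<in> V \<Longrightarrow> x i = 0 \<or> x i = 1"
  by (auto simp: configs_def PiE_iff)

lemma configs_ext:
  assumes "x \<in> configs V" "y \<in> configs V" "\<And>i. i \<in> V \<Longrightarrow> x i = y i"
  shows "x = y"
  using assms unfolding configs_def by (rule PiE_ext)

lemma config_add_unit:
  assumes "x \<in> configs V" "i \<in> V"
  shows "config_add V x (unit_config V i) = x(i := 1 - x i)"
proof
  fix k
  show "config_add V x (unit_config V i) k = (x(i := 1 - x i)) k"
    using configs_cases[OF assms(1), of k] assms
    by (auto simp: config_add_def unit_config_def configs_def PiE_iff extensional_def)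
qed

lemma config_flip_in_configs:
  assumes "x \<in> configs V" "i \<in> V"
  shows "x(i := 1 - x i) \<in> configs V"
  using config_add_unit_in_configs[OF assms(1), of i] config_add_unit[OF assms] by simp

lemma trap_set_async_iff:
  "trap_set V (async_graph V f) X \<longleftrightarrow>
     X \<subseteq> configs V \<and> (\<forall>x\<in>X. \<forall>i\<in>V. f x i \<noteq> x i \<longrightarrow> x(i := 1 - x i) \<in> X)"
  (is "?L \<longleftrightarrow> ?R")
proof
  assume L: ?L
  then have sub: "X \<subseteq> configs V"
    by (simp add: trap_set_def)
  have "x(i := 1 - x i) \<in> X" if "x \<in> X" "i \<in> V" "f x i \<noteq> x i" for x i
  proof -
    have "(x, x(i := 1 - x i)) \<in> async_graph V f"
      using that sub config_add_unit[of x V i] unfolding async_graph_def by force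
    with L that(1) show ?thesis
      unfolding trap_set_def by blast
  qed
  with sub show ?R by blast
next
  assume R: ?R
  then show ?L
    unfolding trap_set_def async_graph_def by (auto simp: config_add_unit)
qed

section \<open>How a network determines the arcs of its graph\<close>

locale network_on_sdigraph = fin_digraph G
  for G :: "'v sdigraph" +
  fixes f :: "'v config \<Rightarrow> 'v config"
  assumes network: "f \<in> networks_on G"
begin

abbreviation "V \<equiv> verts G"
abbreviation "\<Gamma> \<equiv> async_graph V f"

lemma G_eq: "interaction_graph V f = G"
  using network by (simp add: networks_on_def)

lemma tail_eq: "tail G = fst" and head_eq: "head G = fst \<circ> snd"
  using arg_cong[OF G_eq, of tail] arg_cong[OF G_eq, of head]
  unfolding interaction_graph_def mk_sdigraph_def by simp_all

lemma arcs_eq: "arcs G =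
     {(j, i, 1) | j i. j \<in> V \<and> i \<in> V \<and>
         (\<exists>x \<in> configs V. x j = 0 \<and> f (config_add V x (unit_config V j)) i - f x i > 0)} \<union>
     {(j, i, -1) | j i. j \<in> V \<and> i \<in> V \<and>
         (\<exists>x \<in> configs V. x j = 0 \<and> f (config_add V x (unit_config V j)) i - f x i < 0)}"
  using arg_cong[OF G_eq, of arcs] unfolding interaction_graph_def mk_sdigraph_def by simp

lemma arc_verts: "(j, i, s) \<in> arcs G \<Longrightarrow> j \<in> V \<and> i \<in> V"
  by (auto simp: arcs_eq)

lemma arc_sign: "(j, i, s) \<in> arcs G \<Longrightarrow> s = 1 \<or> s = -1"
  by (auto simp: arcs_eq)

lemma f_configs: "x \<in> configs V \<Longrightarrow> f x \<in> configs V"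
  using network by (auto simp: networks_on_def boolean_networks_def)

lemma f_cases: "x \<in> configs V \<Longrightarrow> i \<in> V \<Longrightarrow> f x i = 0 \<or> f x i = 1"
  by (rule configs_cases[OF f_configs])

text \<open>The interaction graph only tests flips from 0 to 1. The product of the two differences
  is symmetric in \<open>x\<close> and \<open>y\<close>, so it gives the sign of the arc for a flip
  in either direction.\<close>

lemma arc_if_flip_changes:
  assumes x: "x \<in> configs V" and j: "j \<in> V" and i: "i \<in> V"
    and y: "y = x(j := 1 - x j)" and ne: "f x i \<noteq> f y i"
  shows "(j, i, (y j - x j) * (f y i - f x i)) \<in> arcs G"
proof -
  have yc: "y \<in> configs V"
    using config_flip_in_configs[OF x j] y by simp
  have arc: "(j, i, f (z(j := 1)) i - f z i) \<in> arcs G"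
    if z: "z \<in> configs V" "z j = 0" "f z i \<noteq> f (z(j := 1)) i" for z
  proof -
    have add: "config_add V z (unit_config V j) = z(j := 1)"
      using config_add_unit[OF z(1) j] z(2) by simp
    have "z(j := 1) \<in> configs V"
      using config_flip_in_configs[OF z(1) j] z(2) by simp
    then consider "f (z(j := 1)) i - f z i = 1" | "f (z(j := 1)) i - f z i = -1"
      using f_cases[OF _ i, of z] f_cases[OF _ i, of "z(j := 1)"] z(1,3) by force
    then show ?thesis
      by cases (use i j z add in \<open>force simp: arcs_eq\<close>)+
  qed
  from configs_cases[OF x j] show ?thesis
  proof
    assume "x j = 0"
    then show ?thesis using arc[OF x] ne y by simp
  next
    assume "x j = 1"
    then have "x = y(j := 1)" "y j = 0" using y by auto
    then show ?thesis using arc[OF yc] ne \<open>x j = 1\<close> by (simp add: algebra_simps)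
  qed
qed

text \<open>Moving from \<open>x\<close> to \<open>y\<close> by flipping differing coordinates one
  at a time, the first flip that changes component \<open>i\<close> of \<open>f\<close> yields the
  arc. Components take two values, so this first change already equals the whole change from
  \<open>f x i\<close> to \<open>f y i\<close>.\<close>

lemma arc_if_differ:
  assumes "x \<in> configs V" and y: "y \<in> configs V" and i: "i \<in> V" and "f x i \<noteq> f y i"
  shows "\<exists>j\<in>V. x j \<noteq> y j \<and> (j, i, (y j - x j) * (f y i - f x i)) \<in> arcs G"
  using assms(1,4)
proof (induction "card {j \<in> V. x j \<noteq> y j}" arbitrary: x rule: less_induct)
  case less
  have "x \<noteq> y"
    using less.prems(2) by auto
  then obtain j where j: "j \<in> V" "x j \<noteq> y j"
    using configs_ext[OF less.prems(1) y] by blast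
  define z where "z = x(j := 1 - x j)"
  have zj: "z j = y j"
    using configs_cases[OF less.prems(1) j(1)] configs_cases[OF y j(1)] j(2)
    by (auto simp: z_def)
  have z: "z \<in> configs V"
    using config_flip_in_configs[OF less.prems(1) j(1)] by (simp add: z_def)
  show ?case
  proof (cases "f x i = f z i")
    case False
    then have "f z i = f y i"
      using f_cases[OF less.prems(1) i] f_cases[OF y i] f_cases[OF z i] less.prems(2) False by argo
    then show ?thesis
      using arc_if_flip_changes[OF less.prems(1) j(1) i z_def False] j zj by auto
  next
    case True
    have "{j \<in> V. z j \<noteq> y j} \<subset> {j \<in> V. x j \<noteq> y j}"
      using j zj by (auto simp: z_def)
    then have "card {j \<in> V. z j \<noteq> y j} < card {j \<in> V. x j \<noteq> y j}"
      by (intro psubset_card_mono) auto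
    from less.hyps[OF this z] True less.prems(2) obtain k where
      k: "k \<in> V" "z k \<noteq> y k" "(k, i, (y k - z k) * (f y i - f z i)) \<in> arcs G" by auto
    then have "z k = x k"
      using zj by (auto simp: z_def)
    then show ?thesis using k True by auto
  qed
qed

section \<open>Signs of walks and the cycles they contain\<close>

lemma awalk_sign:
  "awalk u p v \<Longrightarrow> cycle_sign p = 1 \<or> cycle_sign p = -1"
proof (induction p arbitrary: u)
  case (Cons e p)
  then show ?case
    using arc_sign[of "fst e" "fst (snd e)" "snd (snd e)"] by (fastforce simp: awalk_Cons_iff)
qed simp

text \<open>A repeated vertex splits a closed walk into two shorter closed walks whose signs
  multiply to the sign of the whole, so one of them is negative if the whole is.\<close>

lemma closed_awalk_contains_cycle:
  assumes "awalk u p u" "p \<noteq> []"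
  shows "\<exists>C. cycle C \<and> set C \<subseteq> set p \<and> (cycle_sign p = -1 \<longrightarrow> cycle_sign C = -1)"
  using assms
proof (induction "length p" arbitrary: u p rule: less_induct)
  case less
  obtain e p' where p: "p = e # p'"
    using less.prems(2) by (cases p) auto
  have e: "e \<in> arcs G" "tail G e = u" and p': "awalk (head G e) p' u"
    using less.prems(1) by (auto simp: p awalk_Cons_iff)
  show ?case
  proof (cases "distinct (awalk_verts (head G e) p')")
    case True
    \<comment> \<open>\<open>cycle\<close> asks that \<open>tl (awalk_verts u p)\<close> be
      distinct, and this list is \<open>awalk_verts (head G e) p'\<close>.\<close>
    then have "cycle p"
      using less.prems unfolding cycle_def by (intro exI[of _ u]) (simp add: p)
    then show ?thesis by blast
  next
    case False
    then obtain q r s w where d: "p' = q @ r @ s" "r \<noteq> []"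
      "awalk (head G e) q w" "awalk w r w" "awalk w s u"
      using awalk_not_distinct_decomp[OF p'] by auto
    have outer: "awalk u (e # q @ s) u"
      using e d by (auto simp: awalk_Cons_iff intro: awalk_appendI)
    have sign: "cycle_sign p = cycle_sign r * cycle_sign (e # q @ s)"
      by (simp add: p d(1))
    have "\<exists>C. cycle C \<and> set C \<subseteq> set r \<and> (cycle_sign r = -1 \<longrightarrow> cycle_sign C = -1)"
      using less.hyps[OF _ d(4,2)] by (simp add: p d(1))
    moreover have "\<exists>C. cycle C \<and> set C \<subseteq> set (e # q @ s) \<and>
        (cycle_sign (e # q @ s) = -1 \<longrightarrow> cycle_sign C = -1)"
      using less.hyps[OF _ outer] d(2) by (simp add: p d(1))
    moreover have "set r \<subseteq> set p" "set (e # q @ s) \<subseteq> set p"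
      by (auto simp: p d(1))
    ultimately show ?thesis
      using awalk_sign[OF d(4)] awalk_sign[OF outer] sign by (metis subset_trans mult_1)
  qed
qed

text \<open>With a potential \<open>\<sigma>\<close> of values 1 and -1, every inner vertex of the
  walk contributes a square.\<close>

lemma awalk_sign_telescope:
  assumes "awalk u p v" and "\<sigma> u * \<sigma> u = 1"
    and "\<And>j i s. (j, i, s) \<in> set p \<Longrightarrow> s = \<sigma> j * \<sigma> i \<and> \<sigma> i * \<sigma> i = (1::int)"
  shows "cycle_sign p = \<sigma> u * \<sigma> v"
  using assms
proof (induction p arbitrary: u)
  case Nil
  then show ?case by (simp add: awalk_Nil_iff)
next
  case (Cons e p)
  obtain i s where e: "e = (u, i, s)" and w: "awalk i p v"
    using Cons.prems(1) by (cases e) (auto simp: awalk_Cons_iff tail_eq head_eq)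
  have s: "s = \<sigma> u * \<sigma> i" and i: "\<sigma> i * \<sigma> i = 1"
    using Cons.prems(3)[of u i s] e by auto
  have "cycle_sign p = \<sigma> i * \<sigma> v"
    using Cons.IH[OF w i] Cons.prems(3) by auto
  then have "cycle_sign (e # p) = \<sigma> u * (\<sigma> i * \<sigma> i) * \<sigma> v"
    using s e by simp
  then show ?case
    using i by simp
qed

text \<open>Following chosen predecessors in a finite set must revisit a vertex; the closed walk
  found contains a cycle, and the potential \<open>\<sigma>\<close> makes its sign a square.\<close>

lemma positive_cycle_if_predecessors:
  assumes "finite I" "I \<noteq> {}" "I \<subseteq> V"
    and \<sigma>: "\<And>i. i \<in> I \<Longrightarrow> \<sigma> i * \<sigma> i = (1::int)"
    and pred: "\<And>i. i \<in> I \<Longrightarrow> \<exists>j\<in>I. (j, i, \<sigma> j * \<sigma> i) \<in> arcs G"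
  shows "\<exists>C. positive_cycle G C \<and> cycle_verts G C \<subseteq> I"
proof -
  obtain g where g: "\<And>i. i \<in> I \<Longrightarrow> g i \<in> I \<and> (g i, i, \<sigma> (g i) * \<sigma> i) \<in> arcs G"
    using pred by metis
  define E where "E = {(j, i, s) \<in> arcs G. j \<in> I \<and> i \<in> I \<and> s = \<sigma> j * \<sigma> i}"
  obtain v where v: "v \<in> I" using assms(2) by blast
  have iter: "(g ^^ n) w \<in> I" if "w \<in> I" for n w
    by (induction n) (use that g in auto)
  \<comment> \<open>\<open>g\<close> goes against the arcs, so the walk starts at the iterate and
    ends at \<open>w\<close>.\<close>
  have walk: "\<exists>p. awalk ((g ^^ n) w) p w \<and> length p = n \<and> set p \<subseteq> E" if w: "w \<in> I" for n w
  proof (induction n)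
    case 0
    show ?case using w assms(3) by (auto simp: awalk_Nil_iff)
  next
    case (Suc n)
    then obtain p where p: "awalk ((g ^^ n) w) p w" "length p = n" "set p \<subseteq> E" by blast
    let ?e = "(g ((g ^^ n) w), (g ^^ n) w, \<sigma> (g ((g ^^ n) w)) * \<sigma> ((g ^^ n) w))"
    have "?e \<in> E" using g[OF iter[OF w, of n]] iter[OF w, of n] by (auto simp: E_def)
    then have "awalk ((g ^^ Suc n) w) (?e # p) w \<and> length (?e # p) = Suc n \<and> set (?e # p) \<subseteq> E"
      using p by (auto simp: awalk_Cons_iff tail_eq head_eq E_def)
    then show ?case by blast
  qed
  have "\<not> inj (\<lambda>n. (g ^^ n) v)"
    using finite_subset[of "range (\<lambda>n. (g ^^ n) v)" I] iter[OF v] assms(1)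
      finite_imageD[of "\<lambda>n. (g ^^ n) v" UNIV] by auto
  then obtain m n where "m < n" "(g ^^ m) v = (g ^^ n) v"
    unfolding inj_def by (metis linorder_neqE_nat)
  moreover from this have "(g ^^ (n - m)) ((g ^^ m) v) = (g ^^ n) v"
    using funpow_add[of "n - m" m g] by simp
  ultimately have rep: "(g ^^ (n - m)) ((g ^^ m) v) = (g ^^ m) v" "n - m \<noteq> 0"
    by simp_all
  obtain p where "awalk ((g ^^ m) v) p ((g ^^ m) v)" "p \<noteq> []" "set p \<subseteq> E"
    using walk[OF iter[OF v, of m], of "n - m"] rep by force
  from closed_awalk_contains_cycle[OF this(1,2)] this(3)
  obtain C where C: "cycle C" "set C \<subseteq> E" by blast
  then obtain u where u: "awalk u C u" "C \<noteq> []" by (auto simp: cycle_def)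
  then have "u \<in> I"
    using C(2) by (cases C) (auto simp: awalk_Cons_iff tail_eq E_def)
  have "cycle_sign C = \<sigma> u * \<sigma> u"
    using awalk_sign_telescope[OF u(1), of \<sigma>] \<sigma> \<open>u \<in> I\<close> C(2) by (auto simp: E_def)
  then have "positive_cycle G C"
    using C(1) \<sigma>[OF \<open>u \<in> I\<close>] by (simp add: positive_cycle_def)
  moreover have "cycle_verts G C \<subseteq> I"
    using C(2) by (auto simp: cycle_verts_def tail_eq E_def)
  ultimately show ?thesis by blast
qed

section \<open>Distinct attractors produce a positive cycle\<close>

lemma attractor_flip:
  assumes "attractor V \<Gamma> A" "x \<in> A" "i \<in> V" "f x i \<noteq> x i"
  shows "x(i := 1 - x i) \<in> A"
proof -
  have "trap_set V \<Gamma> A"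
    using assms(1) by (simp add: attractor_def)
  then show ?thesis
    using assms(2-4) by (simp add: trap_set_async_iff)
qed

text \<open>At a pair of minimal distance, \<open>f\<close> fixes both configurations at every
  vertex where they differ, so \<open>arc_if_differ\<close> supplies a predecessor among these
  vertices, with \<open>y i - x i\<close> as potential. They avoid \<open>W\<close>, where the
  attractors agree.\<close>

lemma positive_cycle_between_attractors:
  assumes A: "attractor V \<Gamma> A" and B: "attractor V \<Gamma> B" and "A \<noteq> B"
    and W: "\<And>x y i. x \<in> A \<Longrightarrow> y \<in> B \<Longrightarrow> i \<in> W \<Longrightarrow> x i = y i"
  shows "\<exists>C. positive_cycle G C \<and> cycle_verts G C \<subseteq> V - W"
proof -
  note sub = subsetD[OF attractor_subset_configs[OF A]] subsetD[OF attractor_subset_configs[OF B]]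
  let ?d = "\<lambda>(x, y). card {i \<in> V. x i \<noteq> (y i :: int)}"
  obtain x0 y0 where "x0 \<in> A" "y0 \<in> B"
    using A B by (auto simp: attractor_def)
  then obtain x y where xy: "x \<in> A" "y \<in> B"
    and min: "\<And>x' y'. x' \<in> A \<Longrightarrow> y' \<in> B \<Longrightarrow> ?d (x, y) \<le> ?d (x', y')"
    using ex_has_least_nat[of "\<lambda>(x, y). x \<in> A \<and> y \<in> B" "(x0, y0)" ?d] by auto
  define I where "I = {i \<in> V. x i \<noteq> y i}"
  have cx: "x \<in> configs V" and cy: "y \<in> configs V" using sub xy by auto
  have "x \<noteq> y" using attractors_disjoint[OF A B \<open>A \<noteq> B\<close>] xy by blast
  then have "I \<noteq> {}" using configs_ext[OF cx cy] by (auto simp: I_def)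
  have closer: "card {k \<in> V. x' k \<noteq> y' k} < card I"
    if "i \<in> I" "x' i = y' i" "\<And>k. k \<noteq> i \<Longrightarrow> x' k = x k \<and> y' k = y k" for x' y' i
  proof (rule psubset_card_mono)
    show "{k \<in> V. x' k \<noteq> y' k} \<subset> I" using that by (auto simp: I_def) (metis)+
  qed (simp add: I_def)
  \<comment> \<open>A flip at \<open>i\<close> would stay in its attractor and bring the pair
    closer.\<close>
  have fx: "f x i = x i" and fy: "f y i = y i" and diff: "x i + y i = 1" if i: "i \<in> I" for i
  proof -
    have iV: "i \<in> V" "x i \<noteq> y i" using i by (auto simp: I_def)
    show d: "x i + y i = 1"
      using configs_cases[OF cx iV(1)] configs_cases[OF cy iV(1)] iV(2) by auto
    show "f x i = x i"
    proof (rule ccontr)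
      assume "f x i \<noteq> x i"
      from min[OF attractor_flip[OF A xy(1) iV(1) this] xy(2)]
        closer[OF i, of "x(i := 1 - x i)" y] d show False by (auto simp: I_def)
    qed
    show "f y i = y i"
    proof (rule ccontr)
      assume "f y i \<noteq> y i"
      from min[OF xy(1) attractor_flip[OF B xy(2) iV(1) this]]
        closer[OF i, of x "y(i := 1 - y i)"] d show False by (auto simp: I_def)
    qed
  qed
  have sq: "(y i - x i) * (y i - x i) = 1" if "i \<in> I" for i
    using diff[OF that] configs_cases[OF cx, of i] that by (auto simp: I_def)
  have pred: "\<exists>j\<in>I. (j, i, (y j - x j) * (y i - x i)) \<in> arcs G" if "i \<in> I" for i
    using arc_if_differ[OF cx cy, of i] fx[OF that] fy[OF that] that by (auto simp: I_def)
  have "finite I" "I \<subseteq> V"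
    by (auto simp: I_def)
  from positive_cycle_if_predecessors[OF this(1) \<open>I \<noteq> {}\<close> this(2), of "\<lambda>i. y i - x i"] sq pred
  obtain C where "positive_cycle G C" "cycle_verts G C \<subseteq> I" by blast
  moreover have "I \<subseteq> V - W" using W[OF xy] by (auto simp: I_def)
  ultimately show ?thesis by blast
qed

section \<open>Constancy of attractors away from negative cycles\<close>

text \<open>Switching the vertices with \<open>\<sigma>\<close> equal to -1 makes all arcs inside
  \<open>S\<close> positive, and monotonicity then yields a configuration of \<open>A\<close> fixed
  on \<open>S\<close>. The other inputs of \<open>S\<close> do not vary on \<open>A\<close>, so the
  configurations of \<open>A\<close> that agree with it on \<open>S\<close> form a trap set, which
  is \<open>A\<close> by minimality.\<close>

lemma attractor_constant_on_balanced_component: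
  assumes A: "attractor V \<Gamma> A" and "S \<subseteq> V"
    and \<sigma>: "\<And>i. i \<in> S \<Longrightarrow> \<sigma> i = 1 \<or> \<sigma> i = (-1::int)"
    and balanced: "\<And>j i s. j \<in> S \<Longrightarrow> i \<in> S \<Longrightarrow> (j, i, s) \<in> arcs G \<Longrightarrow> s = \<sigma> j * \<sigma> i"
    and initial: "\<And>j i s. (j, i, s) \<in> arcs G \<Longrightarrow> i \<in> S \<Longrightarrow>
                    j \<in> S \<or> (\<forall>x\<in>A. \<forall>y\<in>A. x j = y j)"
  shows "\<forall>x\<in>A. \<forall>y\<in>A. \<forall>i\<in>S. x i = y i"
proof -
  note sub = subsetD[OF attractor_subset_configs[OF A]]
  have finS: "finite S" using finite_subset[OF \<open>S \<subseteq> V\<close>] by simp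
  \<comment> \<open>The top of \<open>S\<close> after switching: being at \<open>t\<close> counts as
    up.\<close>
  define t where "t i = (if \<sigma> i = 1 then 1 else 0 :: int)" for i
  \<comment> \<open>Monotonicity for one downward flip at \<open>i\<close>: a component of
    \<open>f\<close> that is up afterwards was up before.\<close>
  have mono: "f x j = t j"
    if x: "x \<in> A" "i \<in> S" "j \<in> S" "x i = t i" and y: "f (x(i := 1 - x i)) j = t j" for x i j
  proof (rule ccontr)
    assume ne: "f x j \<noteq> t j"
    let ?y = "x(i := 1 - x i)"
    have V: "i \<in> V" "j \<in> V" using x \<open>S \<subseteq> V\<close> by auto
    have "(i, j, (?y i - x i) * (f ?y j - f x j)) \<in> arcs G"
      using arc_if_flip_changes[OF sub[OF x(1)] V refl] ne y by metis
    from balanced[OF x(2,3) this] show False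
      using \<sigma>[OF x(2)] \<sigma>[OF x(3)] ne y x(4) f_cases[OF sub[OF x(1)] V(2)]
      by (auto simp: t_def split: if_splits)
  qed
  have flip_lower: "{k \<in> S. (x(i := 1 - x i)) k \<noteq> t k} \<subset> {k \<in> S. x k \<noteq> t k}"
    if "x \<in> A" "i \<in> S" "x i \<noteq> t i" for x i
    using that configs_cases[OF sub, of x i] \<open>S \<subseteq> V\<close> by (auto simp: t_def split: if_splits)
  have flip_upper: "{k \<in> S. (x(i := 1 - x i)) k = t k} \<subset> {k \<in> S. x k = t k}"
    if "x \<in> A" "i \<in> S" "x i = t i" for x i
    using that by (auto simp: t_def split: if_splits)
  \<comment> \<open>No vertex of \<open>S\<close> can still go up. A configuration of
    \<open>A\<close> with the most vertices of \<open>S\<close> up has this property.\<close>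
  define P where "P x \<longleftrightarrow> x \<in> A \<and> (\<forall>i\<in>S. f x i = t i \<longrightarrow> x i = t i)" for x
  have "\<exists>x. P x"
  proof -
    let ?m = "\<lambda>x. card {k \<in> S. x k \<noteq> t k}"
    obtain x0 where "x0 \<in> A" using A by (auto simp: attractor_def)
    then obtain x where x: "x \<in> A" and min: "\<And>x'. x' \<in> A \<Longrightarrow> ?m x \<le> ?m x'"
      using ex_has_least_nat[of "\<lambda>x. x \<in> A" x0 ?m] by auto
    have "x i = t i" if i: "i \<in> S" "f x i = t i" for i
    proof (rule ccontr)
      assume ne: "x i \<noteq> t i"
      then have "x(i := 1 - x i) \<in> A"
        using attractor_flip[OF A x, of i] i \<open>S \<subseteq> V\<close> by auto
      then show False
        using min psubset_card_mono[OF _ flip_lower[OF x i(1) ne]] finS by fastforce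
    qed
    then show ?thesis using x by (auto simp: P_def)
  qed
  then obtain x0 where "P x0" ..
  let ?m = "\<lambda>x. card {k \<in> S. x k = t k}"
  \<comment> \<open>Going down preserves \<open>P\<close>, so where the fewest vertices of
    \<open>S\<close> are up, none of them can go down either.\<close>
  obtain x where x: "P x" and min: "\<And>x'. P x' \<Longrightarrow> ?m x \<le> ?m x'"
    using ex_has_least_nat[of P x0 ?m] \<open>P x0\<close> by auto
  have xA: "x \<in> A" using x by (simp add: P_def)
  have down: "f x i = t i" if i: "i \<in> S" "x i = t i" for i
  proof (rule ccontr)
    assume ne: "f x i \<noteq> t i"
    let ?y = "x(i := 1 - x i)"
    have "?y \<in> A" using attractor_flip[OF A xA, of i] i ne \<open>S \<subseteq> V\<close> by auto
    moreover have "?y j = t j" if j: "j \<in> S" "f ?y j = t j" for j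
    proof -
      have "f x j = t j" using mono[OF xA i(1) j(1) i(2) j(2)] .
      \<comment> \<open>\<open>P x\<close> gives \<open>x j = t j\<close>, and \<open>j\<close>
        differs from \<open>i\<close> because \<open>f x i \<noteq> t i\<close>, so the flip leaves
        \<open>j\<close> alone.\<close>
      then show ?thesis using x j(1) ne by (auto simp: P_def)
    qed
    ultimately have "P ?y" by (auto simp: P_def)
    then show False
      using min psubset_card_mono[OF _ flip_upper[OF xA i]] finS by fastforce
  qed
  have fixed: "f x i = x i" if "i \<in> S" for i
  proof -
    have i: "i \<in> V" using that \<open>S \<subseteq> V\<close> by blast
    have "f x i = t i \<longleftrightarrow> x i = t i" using down[OF that] x that by (auto simp: P_def)
    moreover have "t i = 0 \<or> t i = 1" by (simp add: t_def)
    ultimately show ?thesis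
      using configs_cases[OF sub[OF xA] i] f_cases[OF sub[OF xA] i] by metis
  qed
  define B where "B = {y \<in> A. \<forall>i\<in>S. y i = x i}"
  have "trap_set V \<Gamma> B"
    unfolding trap_set_async_iff
  proof (intro conjI ballI impI)
    show "B \<subseteq> configs V" using sub by (auto simp: B_def)
    fix y i assume y: "y \<in> B" and i: "i \<in> V" "f y i \<noteq> y i"
    have yA: "y \<in> A" and yS: "\<And>k. k \<in> S \<Longrightarrow> y k = x k" using y by (auto simp: B_def)
    have "i \<notin> S"
    proof
      assume iS: "i \<in> S"
      then have "f x i \<noteq> f y i" using fixed yS i by auto
      \<comment> \<open>Component \<open>i\<close> of \<open>f\<close> can only change through an
        input that varies on \<open>A\<close>; by \<open>initial\<close> it lies in
        \<open>S\<close>, where \<open>x\<close> and \<open>y\<close> agree.\<close>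
      from arc_if_differ[OF sub[OF xA] sub[OF yA] i(1) this] obtain j s
        where "x j \<noteq> y j" "(j, i, s) \<in> arcs G" by blast
      then show False using initial[OF _ iS] yS xA yA by metis
    qed
    then show "y(i := 1 - y i) \<in> B"
      using attractor_flip[OF A yA i] yS by (auto simp: B_def)
  qed
  moreover have "x \<in> B" "B \<subseteq> A" using xA by (auto simp: B_def)
  ultimately have "B = A" using A unfolding attractor_def by blast
  then have "y i = x i" if "y \<in> A" "i \<in> S" for y i
    using that by (auto simp: B_def)
  then show ?thesis by metis
qed

text \<open>Among the vertices of \<open>W\<close> that vary on \<open>A\<close>, one with the
  fewest ancestors lies in an initial strong component. All closed walks in it are positive, so the
  signs of walks from that vertex define a balancing \<open>\<sigma>\<close>, and constancy on the
  component contradicts the choice of the vertex.\<close>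

lemma attractor_constant_if_no_negative_cycle:
  assumes A: "attractor V \<Gamma> A" and "W \<subseteq> V"
    and preds: "\<And>j i s. (j, i, s) \<in> arcs G \<Longrightarrow> i \<in> W \<Longrightarrow> j \<in> W"
    and no_neg: "\<And>C. negative_cycle G C \<Longrightarrow> cycle_verts G C \<inter> W = {}"
  shows "\<forall>x\<in>A. \<forall>y\<in>A. \<forall>i\<in>W. x i = y i"
proof (rule ccontr)
  assume varies: "\<not> ?thesis"
  define F where "F = {i \<in> W. \<exists>x\<in>A. \<exists>y\<in>A. x i \<noteq> y i}"
  then obtain v0 where "v0 \<in> F"
    using varies by auto
  have FV: "F \<subseteq> V" using \<open>W \<subseteq> V\<close> by (auto simp: F_def)
  define E where "E = {(j, i, s) \<in> arcs G. j \<in> F \<and> i \<in> F}"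
  \<comment> \<open>Ancestors along walks that stay among the varying vertices; the empty walk makes
    a vertex of \<open>F\<close> its own ancestor.\<close>
  define anc where "anc w = {u. \<exists>p. awalk u p w \<and> set p \<subseteq> E}" for w
  have anc_V: "anc w \<subseteq> V" for w
    by (auto simp: anc_def awalk_hd_in_verts)
  have anc_trans: "anc u \<subseteq> anc w" if u: "u \<in> anc w" for u w
  proof
    fix x assume "x \<in> anc u"
    then obtain p q where "awalk x p u" "set p \<subseteq> E" "awalk u q w" "set q \<subseteq> E"
      using u unfolding anc_def by blast
    then have "awalk x (p @ q) w" "set (p @ q) \<subseteq> E"
      by (auto intro: awalk_appendI)
    then show "x \<in> anc w"
      unfolding anc_def by blast
  qed
  have anc_F: "anc w \<subseteq> F" if w: "w \<in> F" for w
  proof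
    fix u assume "u \<in> anc w"
    then obtain p where p: "awalk u p w" "set p \<subseteq> E" by (auto simp: anc_def)
    show "u \<in> F"
    proof (cases p)
      case Nil
      then show ?thesis using p w by (simp add: awalk_Nil_iff)
    next
      case (Cons e q)
      then show ?thesis using p by (auto simp: awalk_Cons_iff tail_eq E_def)
    qed
  qed
  obtain v where v: "v \<in> F" and min: "\<And>w. w \<in> F \<Longrightarrow> card (anc v) \<le> card (anc w)"
    using ex_has_least_nat[of "\<lambda>w. w \<in> F" v0 "\<lambda>w. card (anc w)"] \<open>v0 \<in> F\<close> by auto
  define S where "S = anc v"
  have vS: "v \<in> S"
    using v FV by (auto simp: S_def anc_def awalk_Nil_iff intro!: exI[of _ "[]"])
  have SF: "S \<subseteq> F" using anc_F[OF v] by (simp add: S_def)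
  have from_v: "\<exists>p. awalk v p u \<and> set p \<subseteq> E" if u: "u \<in> S" for u
  proof -
    \<comment> \<open>\<open>anc u\<close> is contained in \<open>anc v\<close>, which has least
      size. Hence \<open>v\<close> is also an ancestor of \<open>u\<close>, and \<open>S\<close> is
      strongly connected.\<close>
    have "anc u = anc v"
      using card_seteq[of "anc v" "anc u"] finite_subset[OF anc_V] anc_trans[of u v] u
        min[of u] SF by (auto simp: S_def)
    then show ?thesis using vS by (auto simp: S_def anc_def)
  qed
  have closed_pos: "cycle_sign p = 1" if p: "awalk u p u" "set p \<subseteq> E" for u p
  proof (rule ccontr)
    assume "cycle_sign p \<noteq> 1"
    then have neg: "cycle_sign p = -1" using awalk_sign[OF p(1)] by simp
    then have "p \<noteq> []" by auto
    from closed_awalk_contains_cycle[OF p(1) this] neg obtain C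
      where C: "cycle C" "set C \<subseteq> set p" "cycle_sign C = -1" by auto
    then have "C \<noteq> []" by (auto simp: cycle_def)
    then have "cycle_verts G C \<inter> W \<noteq> {}"
      using C(2) p(2) by (cases C) (auto simp: cycle_verts_def tail_eq E_def F_def)
    then show False using no_neg[of C] C by (simp add: negative_cycle_def)
  qed
  obtain \<pi> where \<pi>: "\<And>u. u \<in> S \<Longrightarrow> awalk v (\<pi> u) u \<and> set (\<pi> u) \<subseteq> E"
    using from_v by metis
  define \<sigma> where "\<sigma> u = cycle_sign (\<pi> u)" for u
  have "\<forall>x\<in>A. \<forall>y\<in>A. \<forall>i\<in>S. x i = y i"
  proof (rule attractor_constant_on_balanced_component[OF A])
    show "S \<subseteq> V" using SF FV by blast
    show \<sigma>: "\<sigma> i = 1 \<or> \<sigma> i = -1" if "i \<in> S" for i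
      using awalk_sign \<pi>[OF that] by (auto simp: \<sigma>_def)
    show "s = \<sigma> j * \<sigma> i" if j: "j \<in> S" and i: "i \<in> S" and a: "(j, i, s) \<in> arcs G" for j i s
    proof -
      obtain r where r: "awalk i r v" "set r \<subseteq> E" using i by (auto simp: S_def anc_def)
      have aE: "(j, i, s) \<in> E" using a i j SF by (auto simp: E_def)
      have "awalk j ((j, i, s) # r) v"
        using a r(1) by (simp add: awalk_Cons_iff tail_eq head_eq)
      \<comment> \<open>Two walks from \<open>v\<close> to \<open>i\<close>, one through
        \<open>j\<close> and the chosen one, are closed up by the same \<open>r\<close>; comparing
        the two products isolates \<open>s\<close>.\<close>
      then have "cycle_sign (\<pi> j @ (j, i, s) # r) = 1"
        by (intro closed_pos[of v]) (use \<pi>[OF j] r aE in \<open>auto intro: awalk_appendI\<close>)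
      moreover have "cycle_sign (\<pi> i @ r) = 1"
        by (intro closed_pos[of v]) (use \<pi>[OF i] r in \<open>auto intro: awalk_appendI\<close>)
      ultimately show ?thesis
        using \<sigma>[OF i] \<sigma>[OF j] awalk_sign[OF r(1)] arc_sign[OF a] by (auto simp: \<sigma>_def)
    qed
    show "j \<in> S \<or> (\<forall>x\<in>A. \<forall>y\<in>A. x j = y j)" if a: "(j, i, s) \<in> arcs G" and i: "i \<in> S" for j i s
    proof (rule disjCI)
      assume "\<not> (\<forall>x\<in>A. \<forall>y\<in>A. x j = y j)"
      \<comment> \<open>\<open>preds\<close> keeps \<open>j\<close> in \<open>W\<close>, so a
        varying \<open>j\<close> is in \<open>F\<close> and prolongs an ancestor walk of
        \<open>v\<close> backwards.\<close>
      then have "j \<in> F" using preds[OF a] i SF by (auto simp: F_def)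
      obtain r where r: "awalk i r v" "set r \<subseteq> E" using i by (auto simp: S_def anc_def)
      have "(j, i, s) \<in> E" using a i \<open>j \<in> F\<close> SF by (auto simp: E_def)
      moreover have "awalk j ((j, i, s) # r) v"
        using a r(1) by (simp add: awalk_Cons_iff tail_eq head_eq)
      ultimately have "j \<in> anc v"
        using r(2) unfolding anc_def by (auto intro!: exI[of _ "(j, i, s) # r"])
      then show "j \<in> S" by (simp add: S_def)
    qed
  qed
  with vS v show False by (auto simp: F_def)
qed

section \<open>Trap closures and the conclusion\<close>

text \<open>\<open>W\<close> is closed under predecessors, so on \<open>W\<close> the values of
  \<open>f\<close> depend on \<open>W\<close> only. As \<open>A\<close> cannot move there, fixing
  the values of \<open>a\<close> on \<open>W\<close> gives a trap space around \<open>A\<close>, and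
  the closure lies inside it.\<close>

lemma trap_closure_constant:
  assumes A: "attractor V \<Gamma> A" and "W \<subseteq> V"
    and preds: "\<And>j i s. (j, i, s) \<in> arcs G \<Longrightarrow> i \<in> W \<Longrightarrow> j \<in> W"
    and const: "\<forall>x\<in>A. \<forall>y\<in>A. \<forall>i\<in>W. x i = y i"
    and a: "a \<in> A" and z: "z \<in> trap_closure V \<Gamma> A" and i: "i \<in> W"
  shows "z i = a i"
proof -
  note sub = attractor_subset_configs[OF A]
  have ac: "a \<in> configs V" using a sub by blast
  have fa: "f a k = a k" if k: "k \<in> W" for k
  proof (rule ccontr)
    assume "f a k \<noteq> a k"
    then have "a(k := 1 - a k) \<in> A" using attractor_flip[OF A a, of k] k \<open>W \<subseteq> V\<close> by auto
    then have "(a(k := 1 - a k)) k = a k" using const a k by blast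
    then show False by (simp, presburger)
  qed
  let ?Y = "{x \<in> configs V. \<forall>k\<in>W. x k = a k}"
  have "is_subspace V ?Y"
    unfolding is_subspace_def
    using \<open>W \<subseteq> V\<close> configs_cases[OF ac] by (intro exI[of _ W] exI[of _ a]) auto
  moreover have "trap_set V \<Gamma> ?Y"
    unfolding trap_set_async_iff
  proof (intro conjI ballI impI)
    fix x k assume x: "x \<in> ?Y" and k: "k \<in> V" "f x k \<noteq> x k"
    have "k \<notin> W"
    proof
      assume kW: "k \<in> W"
      then have "f x k \<noteq> f a k" using fa x k by auto
      with arc_if_differ[of x a k] x ac k(1) obtain j s where "x j \<noteq> a j" "(j, k, s) \<in> arcs G"
        by blast
      then show False using preds[OF _ kW] x by blast
    qed
    then show "x(k := 1 - x k) \<in> ?Y"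
      using x config_flip_in_configs[of x V k] k by auto
  qed auto
  moreover have "A \<subseteq> ?Y" using const a sub by auto
  ultimately have "trap_closure V \<Gamma> A \<subseteq> ?Y"
    using trap_closure_least(3)[of A V f ?Y] a sub by (auto simp: trap_space_def)
  then show ?thesis using z i by blast
qed

lemma trap_separating_if_no_negative_to_positive_path:
  assumes "\<not> (\<exists>C C' p. negative_cycle G C \<and> positive_cycle G C' \<and> path_between_cycles G C p C')"
  shows "trap_separating_graph V \<Gamma>"
proof -
  \<comment> \<open>With walks instead of paths, \<open>U\<close> is closed under arcs by appending;
    \<open>apath_awalk_to_apath\<close> recovers a path at the end.\<close>
  define U where "U = {v. \<exists>C p. \<exists>u\<in>cycle_verts G C. negative_cycle G C \<and> awalk u p v}"
  define W where "W = V - U"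
  have WV: "W \<subseteq> V" by (auto simp: W_def)
  have preds: "j \<in> W" if a: "(j, i, s) \<in> arcs G" and i: "i \<in> W" for j i s
  proof (rule ccontr)
    assume "j \<notin> W"
    then obtain C p u where "u \<in> cycle_verts G C" "negative_cycle G C" and p: "awalk u p j"
      using arc_verts[OF a] by (auto simp: W_def U_def)
    moreover have "awalk u (p @ [(j, i, s)]) i"
      using p a arc_verts[OF a]
      by (intro awalk_appendI[OF p]) (simp add: awalk_Cons_iff awalk_Nil_iff tail_eq head_eq)
    ultimately show False using i unfolding W_def U_def by blast
  qed
  have no_neg: "cycle_verts G C \<inter> W = {}" if "negative_cycle G C" for C
  proof -
    \<comment> \<open>The walk of length zero suffices.\<close>
    have "v \<in> U" if v: "v \<in> cycle_verts G C" "v \<in> V" for v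
      using v \<open>negative_cycle G C\<close> awalk_Nil_iff[of v v] by (auto simp: U_def)
    then show ?thesis by (auto simp: W_def)
  qed
  have no_pos: "\<not> cycle_verts G C' \<subseteq> V - W" if C': "positive_cycle G C'" for C'
  proof
    assume sub: "cycle_verts G C' \<subseteq> V - W"
    have "C' \<noteq> []" using C' by (auto simp: positive_cycle_def cycle_def)
    then obtain v where v: "v \<in> cycle_verts G C'" by (cases C') (auto simp: cycle_verts_def)
    then obtain C p u where "u \<in> cycle_verts G C" "negative_cycle G C" "awalk u p v"
      using sub unfolding W_def U_def by blast
    then show False
      using assms C' v apath_awalk_to_apath[of u p v] by (auto simp: path_between_cycles_def)
  qed
  have "trap_closure V \<Gamma> A \<inter> trap_closure V \<Gamma> B = {}"
    if A: "attractor V \<Gamma> A" and B: "attractor V \<Gamma> B" and "A \<noteq> B" for A B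
  proof (rule ccontr)
    assume "trap_closure V \<Gamma> A \<inter> trap_closure V \<Gamma> B \<noteq> {}"
    then obtain z where z: "z \<in> trap_closure V \<Gamma> A" "z \<in> trap_closure V \<Gamma> B" by blast
    note const = attractor_constant_if_no_negative_cycle[OF _ WV preds no_neg]
    \<comment> \<open>On \<open>W\<close> the common point \<open>z\<close> of the closures carries
      the values of both attractors.\<close>
    have "x i = y i" if "x \<in> A" "y \<in> B" "i \<in> W" for x y i
      using trap_closure_constant[OF A WV preds const[OF A] that(1) z(1) that(3)]
        trap_closure_constant[OF B WV preds const[OF B] that(2) z(2) that(3)] by simp
    then have "\<exists>C. positive_cycle G C \<and> cycle_verts G C \<subseteq> V - W"
      by (rule positive_cycle_between_attractors[OF A B \<open>A \<noteq> B\<close>])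
    with no_pos show False by blast
  qed
  then show ?thesis by (auto simp: trap_separating_graph_def)
qed

end

theorem theorem10:
  fixes G :: "'v sdigraph"
  assumes "signed_digraph G"
    and "\<not> (\<exists>C C' p. negative_cycle G C \<and> positive_cycle G C' \<and> path_between_cycles G C p C')"
  shows "trap_separating G"
  unfolding trap_separating_def
proof
  fix f assume "f \<in> networks_on G"
  then interpret network_on_sdigraph G f
    using signed_digraph_imp_fin_digraph[OF assms(1)]
    by (simp add: network_on_sdigraph_def network_on_sdigraph_axioms_def)
  show "trap_separating_graph (verts G) (async_graph (verts G) f)"
    using trap_separating_if_no_negative_to_positive_path[OF assms(2)] .
qed

end
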